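(* Let $G$ be a finite group of order $L\ge2$ and let $\tilde p\ge0$. If $$\tilde p<\tilde p^*_L:=\sqrt{\frac{2(L-1)\log(L-1)}{L(L-2)}}$$ (where for $L=2$ we set $\tilde p^*_2=1$, the limit value of the $0/0$ expression), then $\mathrm{ToH}_n(\tilde p,G)$ is contiguous to $\mathrm{ToH}_n(0,G)$.
   Context: Truth-or-Haar model $\mathrm{ToH}_n(\tilde p,G)$ (for a finite group $G$ and $n$ large enough that $p:=\tilde p/\sqrt n\le1$): draw $g\in G^n$ with coordinates $g_u$ independent and uniform on $G$. Independently for each unordered pair $\{u,v\}$ with $u\ne v$, say $u<v$: with probability $p=\tilde p/\sqrt n$ let $Y_{uv}=g_ug_v^{-1}$, and otherwise let $Y_{uv}$ be uniform on $G$ (independent of everything else). Define $Y_{vu}=(Y_{uv})^{-1}$ and $Y_{uu}=1$ (the identity). The model is the law of the matrix $Y\in G^{n\times n}$. Contiguity: for sequences of probability measures $P_n,Q_n$ on measurable spaces $(\Omega_n,\mathcal{F}_n)$, $P_n$ is contiguous to $Q_n$ if for every sequence of events $A_n\in\mathcal{F}_n$, $Q_n(A_n)\to0$ implies $P_n(A_n)\to0$ as $n\to\infty$. *)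

theory Defs
  imports "HOL-Probability.Probability" "HOL-Algebra.Coset"
begin

text \<open>
  For each \<open>n\<close>, \<open>P n\<close> and \<open>Q n\<close> are meant to be probability measures on the same measurable
  space, so that \<open>sets (Q n)\<close> is the common sigma-algebra.
\<close>

definition contiguous :: "(nat \<Rightarrow> 'a measure) \<Rightarrow> (nat \<Rightarrow> 'a measure) \<Rightarrow> bool" where
  "contiguous P Q \<longleftrightarrow>
     (\<forall>A. (\<forall>n. A n \<in> sets (Q n)) \<longrightarrow>
          (\<lambda>n. measure (Q n) (A n)) \<longlonglongrightarrow> 0 \<longrightarrow>
          (\<lambda>n. measure (P n) (A n)) \<longlonglongrightarrow> 0)"

text \<open>
  The Truth-or-Haar model.  Vertices are \<open>0, \<dots>, n - 1\<close>; an \<open>n \<times> n\<close> matrix over \<open>G\<close> is a function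
  on index pairs that is \<open>undefined\<close> outside \<open>{..<n} \<times> {..<n}\<close>.

  \<open>toh_entry\<close> is the law of \<open>Y\<^sub>u\<^sub>v\<close> (for \<open>u < v\<close>) given that \<open>a\<close> is the true value
  \<open>g\<^sub>u g\<^sub>v\<^sup>-\<^sup>1\<close>.  The model is defined only if \<open>pt / sqrt n \<le> 1\<close>; for the finitely many smaller \<open>n\<close>,
  \<open>bernoulli_pmf\<close> truncates its parameter to \<open>[0, 1]\<close>, which does not affect contiguity.
\<close>

definition toh_entry :: "('a, 'b) monoid_scheme \<Rightarrow> real \<Rightarrow> 'a \<Rightarrow> 'a pmf" where
  "toh_entry G p a =
     bernoulli_pmf p \<bind> (\<lambda>truth. if truth then return_pmf a else pmf_of_set (carrier G))"

definition toh_matrix ::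
    "('a, 'b) monoid_scheme \<Rightarrow> nat \<Rightarrow> (nat \<times> nat \<Rightarrow> 'a) \<Rightarrow> (nat \<times> nat \<Rightarrow> 'a)" where
  "toh_matrix G n y =
     (\<lambda>(u, v) \<in> {..<n} \<times> {..<n}.
        if u < v then y (u, v)
        else if u = v then \<one>\<^bsub>G\<^esub>
        else inv\<^bsub>G\<^esub> (y (v, u)))"

definition ToH :: "nat \<Rightarrow> real \<Rightarrow> ('a, 'b) monoid_scheme \<Rightarrow> (nat \<times> nat \<Rightarrow> 'a) pmf" where
  "ToH n pt G =
     Pi_pmf {..<n} undefined (\<lambda>_. pmf_of_set (carrier G)) \<bind> (\<lambda>g.
     Pi_pmf {(u, v). u < v \<and> v < n} undefined
       (\<lambda>(u, v). toh_entry G (pt / sqrt (real n)) (g u \<otimes>\<^bsub>G\<^esub> inv\<^bsub>G\<^esub> (g v))) \<bind> (\<lambda>y.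
     return_pmf (toh_matrix G n y)))"

definition toh_threshold :: "nat \<Rightarrow> real" where
  "toh_threshold L =
     (if L = 2 then 1
      else sqrt (2 * (real L - 1) * ln (real L - 1) / (real L * (real L - 2))))"

end

theory Submission
  imports Defs
begin

text \<open>
  Second moment method.  The second moment of the likelihood ratio between \<open>ToH\<^sub>n(pt, G)\<close> and
  \<open>ToH\<^sub>n(0, G)\<close> is an average over two independent labellings \<open>g, h\<close>; it depends only on
  \<open>k\<^sub>u = h\<^sub>u\<^sup>-\<^sup>1 g\<^sub>u\<close>, which is again uniform, and is at most the mean of
  \<open>exp (pt\<^sup>2 L / (2 n) * |x|\<^sup>2)\<close>, where \<open>x\<^sub>a = card {u. k\<^sub>u = a} - n / L\<close>.  Writing this exponential of a
  square as a Gaussian average of exponentials of linear forms decouples the vertices, and it remains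
  bounded in \<open>n\<close> as soon as a centred uniform basis vector of \<open>\<real>\<^sup>L\<close> is sub-Gaussian with variance
  proxy \<open>1 / (L * toh_threshold L\<^sup>2)\<close>.  The latter holds because, for a given norm of a centred
  \<open>z\<close>, the sum of the \<open>exp (z\<^sub>a)\<close> is largest when all coordinates but one are equal; this reduces it to
  the sharp sub-Gaussian bound for a Bernoulli variable with parameter \<open>1 / L\<close> (Kearns--Saul).
\<close>

section \<open>Sharp exponential inequalities in one variable\<close>

text \<open>The quadratic is tangent to \<open>exp\<close> at \<open>0\<close> and meets it again at
  \<open>d\<close>. Its leading coefficient is the value at \<open>d\<close> of a monotone function,
  whose value at \<open>w\<close> would give equality at \<open>w\<close>.\<close>

lemma exp_le_quadratic:
  fixes w d :: real
  assumes "0 < d" "w \<le> d"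
  shows "exp w \<le> 1 + w + (exp d - 1 - d) / d\<^sup>2 * w\<^sup>2"
proof -
  text \<open>\<open>m x = (exp x - 1 - x) / x\<^sup>2\<close> is increasing.\<close>
  define m where "m = (\<lambda>x::real. \<Sum>n. x ^ n / fact (n + 2))"
  have summ: "summable (\<lambda>n. x ^ n / fact (n + 2))" for x :: real
  proof (rule summable_comparison_test'[where N = 0])
    show "summable (\<lambda>n. \<bar>x\<bar> ^ n /\<^sub>R fact n)" by (rule summable_exp_generic)
    fix n :: nat
    have "\<bar>x\<bar> ^ n / fact (n + 2) \<le> \<bar>x\<bar> ^ n / fact n"
      by (intro divide_left_mono fact_mono) auto
    then show "norm (x ^ n / fact (n + 2)) \<le> \<bar>x\<bar> ^ n /\<^sub>R fact n"
      by (simp add: power_abs abs_mult divide_inverse mult.commute del: fact_Suc)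
  qed
  have m: "exp x = 1 + x + x\<^sup>2 * m x" for x :: real
  proof -
    have "exp x = (\<Sum>n. x ^ n /\<^sub>R fact n)" by (simp add: exp_def)
    also have "\<dots> = (\<Sum>n. x ^ (n + 2) /\<^sub>R fact (n + 2)) + (\<Sum>n<2. x ^ n /\<^sub>R fact n)"
      by (rule suminf_split_initial_segment) (rule summable_exp_generic)
    also have "(\<Sum>n. x ^ (n + 2) /\<^sub>R fact (n + 2)) = x\<^sup>2 * m x"
      unfolding m_def by (subst suminf_mult[OF summ, symmetric])
        (simp add: field_simps power_add power2_eq_square)
    finally show ?thesis by (simp add: numeral_2_eq_2)
  qed
  have "m w \<le> m d"
  proof (cases "w \<ge> 0")
    case True
    show ?thesis unfolding m_def
      by (rule suminf_le[OF _ summ summ]) (use True assms in \<open>auto intro!: divide_right_mono power_mono\<close>)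
  next
    case False
    \<comment> \<open>For negative \<open>w\<close> the series cannot be compared term by term, so
      both sides are compared with \<open>m 0 = 1 / 2\<close> instead.\<close>
    have "1 / 2 = (\<Sum>n<1. d ^ n / fact (n + 2))" by simp
    also have "\<dots> \<le> m d" unfolding m_def
      by (rule sum_le_suminf[OF summ]) (use assms in auto)
    finally have 1: "1 / 2 \<le> m d" .
    have D: "exp w \<le> 1 + w + w\<^sup>2 / 2"
    proof -
      define f where "f = (\<lambda>x::real. 1 + x + x\<^sup>2 / 2 - exp x)"
      have "(f has_real_derivative 1 + x - exp x) (at x)" for x
        unfolding f_def by (auto intro!: derivative_eq_intros)
      moreover have "1 + x - exp x \<le> 0" for x :: real using exp_ge_add_one_self[of x] by simp
      ultimately have "f 0 \<le> f w"
        using DERIV_nonpos_imp_nonincreasing[of w 0 f] False by (meson linear)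
      then show ?thesis by (simp add: f_def)
    qed
    with m[of w] have "w\<^sup>2 * m w \<le> w\<^sup>2 * (1 / 2)" by simp
    with False have "m w \<le> 1 / 2" by (simp add: mult_le_cancel_left power2_eq_square zero_less_mult_iff)
    with 1 show ?thesis by simp
  qed
  then have "w\<^sup>2 * m w \<le> w\<^sup>2 * m d" by (rule mult_left_mono) simp
  moreover have "m d = (exp d - 1 - d) / d\<^sup>2" using m[of d] assms by (simp add: field_simps)
  ultimately show ?thesis using m[of w] by (simp add: mult.commute)
qed

text \<open>The second derivative of the left side is a Bernoulli variance, hence at most
  \<open>1 / 4\<close>; integrating twice from \<open>0\<close> gives the bound. It serves the case
  \<open>L = 2\<close>.\<close>

lemma hoeffding_bernoulli_half:
  fixes t :: real
  assumes "0 \<le> t"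
  shows "ln (1 + exp t) \<le> ln 2 + t / 2 + t\<^sup>2 / 8"
proof -
  define f where "f = (\<lambda>t::real. ln (1 + exp t) - t / 2 - t\<^sup>2 / 8)"
  define g where "g = (\<lambda>t::real. exp t / (1 + exp t) - 1 / 2 - t / 4)"
  have pos: "1 + exp x > 0" for x :: real by (simp add: add_pos_pos)
  have nz: "1 + exp x \<noteq> 0" for x :: real using pos[of x] by linarith
  have df: "(f has_real_derivative g x) (at x)" for x
    unfolding f_def g_def by (auto intro!: derivative_eq_intros simp: pos)
  have dg: "(g has_real_derivative (exp x / (1 + exp x)\<^sup>2 - 1 / 4)) (at x)" for x
    unfolding g_def by (auto intro!: derivative_eq_intros simp: nz) (simp add: field_simps power2_eq_square nz)
  have "exp x / (1 + exp x)\<^sup>2 - 1 / 4 \<le> 0" for x :: real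
  proof -
    have "4 * exp x \<le> (1 + exp x)\<^sup>2"
      using zero_le_power2[of "1 - exp x"] by (simp add: power2_eq_square algebra_simps)
    then show ?thesis using pos[of x] by (simp add: divide_simps nz)
  qed
  then have "g x \<le> g 0" if "0 \<le> x" for x
    using DERIV_nonpos_imp_nonincreasing[of 0 x g] that dg by blast
  then have "g x \<le> 0" if "0 \<le> x" for x using that by (simp add: g_def)
  then have "f t \<le> f 0"
    using DERIV_nonpos_imp_nonincreasing[of 0 t f] assms df by blast
  then show ?thesis by (simp add: f_def)
qed

text \<open>A Bernoulli variable with parameter \<open>p = 1 / (k + 1)\<close>; the case \<open>p = 1 / 2\<close>, where the constant
  below would be \<open>0 / 0\<close>, is the previous lemma.\<close>
lemma kearns_saul:
  fixes k t :: real
  assumes k: "1 < k" and t: "0 \<le> t"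
  shows "ln (k + exp t) \<le> ln (k + 1) + t / (k + 1) + (k - 1) / (4 * (k + 1) * ln k) * t\<^sup>2"
proof -
  \<comment> \<open>This value of \<open>a\<close> is forced by requiring equality at
    \<open>t = 2 * ln k\<close> as well as at \<open>t = 0\<close>.\<close>
  define a where "a = (k - 1) / (4 * (k + 1) * ln k)"
  define \<tau> where "\<tau> = ln k"
  define f where "f = (\<lambda>t. ln (k + exp t) - ln (k + 1) - t / (k + 1) - a * t\<^sup>2)"
  define g where "g = (\<lambda>t. exp t / (k + exp t) - 1 / (k + 1) - 2 * a * t)"
  define h where "h = (\<lambda>t. k * exp t / (k + exp t)\<^sup>2 - 2 * a)"
  define h' where "h' = (\<lambda>t. k * exp t * (k - exp t) / (k + exp t) ^ 3)"
  have \<tau>: "0 < \<tau>" "exp \<tau> = k" using k by (auto simp: \<tau>_def)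
  have pos: "k + exp x > 0" for x using k by (simp add: add_pos_pos)
  have nz: "k + exp x \<noteq> 0" for x using pos[of x] by linarith
  have df: "(f has_real_derivative g x) (at x)" for x
  proof -
    define c where "c = k + 1"
    have "c \<noteq> 0" using k by (simp add: c_def)
    then show ?thesis
      unfolding f_def g_def c_def[symmetric] by (auto intro!: derivative_eq_intros simp: pos)
  qed
  have dg: "(g has_real_derivative h x) (at x)" for x
  proof -
    define c where "c = 1 / (k + 1)"
    have "(g has_real_derivative ((exp x * (k + exp x) - exp x * exp x) / (k + exp x)\<^sup>2 - 2 * a)) (at x)"
      unfolding g_def c_def[symmetric] by (auto intro!: derivative_eq_intros simp: nz power2_eq_square)
    then show ?thesis by (simp add: h_def algebra_simps)
  qed
  have dh: "(h has_real_derivative h' x) (at x)" for x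
  proof -
    have "(h has_real_derivative (k * exp x * (k + exp x)\<^sup>2 - k * exp x * (2 * (k + exp x) * exp x))
            / ((k + exp x)\<^sup>2 * (k + exp x)\<^sup>2)) (at x)"
      unfolding h_def by (auto intro!: derivative_eq_intros simp: nz)
    moreover have "(k * E * (k + E)\<^sup>2 - k * E * (2 * (k + E) * E)) / ((k + E)\<^sup>2 * (k + E)\<^sup>2)
       = k * E * (k - E) / (k + E) ^ 3" if "k + E \<noteq> 0" for E
      using that by (simp add: divide_simps) algebra
    ultimately show ?thesis unfolding h'_def using nz[of x] by simp
  qed
  text \<open>The derivative \<open>g\<close> vanishes at \<open>0\<close>, \<open>\<tau>\<close>, \<open>2 \<tau>\<close>, is convex before \<open>\<tau>\<close> and concave after it;
    moreover \<open>f\<close> vanishes at \<open>0\<close> and \<open>2 \<tau>\<close>.\<close>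
  have \<tau>a: "2 * a * \<tau> = (k - 1) / (2 * (k + 1))"
  proof -
    have "2 * (m / (4 * p * s)) * s = m / (2 * p)" if "s \<noteq> 0" "p \<noteq> 0" for m p s :: real
      using that by (simp add: field_simps)
    then show ?thesis unfolding a_def \<tau>_def[symmetric] using \<tau>(1) k by (metis add_pos_pos less_trans order_less_irrefl zero_less_one)
  qed
  have g0: "g 0 = 0" by (simp add: g_def)
  have g1: "g \<tau> = 0" unfolding g_def \<tau>a \<tau>(2) using k by (simp add: field_simps)
  have e2: "exp (2 * \<tau>) = k\<^sup>2" using \<tau>(2) by (simp add: exp_double)
  have "g (2 * \<tau>) = k\<^sup>2 / (k + k\<^sup>2) - 1 / (k + 1) - 2 * (2 * a * \<tau>)" by (simp add: g_def e2)
  also have "\<dots> = 0" unfolding \<tau>a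
  proof -
    have "k\<^sup>2 / (k + k\<^sup>2) = (k * k) / (k * (k + 1))" by (simp add: power2_eq_square algebra_simps)
    also have "\<dots> = k / (k + 1)" using k by simp
    finally have "k\<^sup>2 / (k + k\<^sup>2) = k / (k + 1)" .
    moreover have "k / p - 1 / p - 2 * ((k - 1) / (2 * p)) = 0" for p
      by (simp add: diff_divide_distrib)
    ultimately show "k\<^sup>2 / (k + k\<^sup>2) - 1 / (k + 1) - 2 * ((k - 1) / (2 * (k + 1))) = 0"
      by metis
  qed
  finally have g2: "g (2 * \<tau>) = 0" .
  have f0: "f 0 = 0" by (simp add: f_def)
  have "f (2 * \<tau>) = ln (k + k\<^sup>2) - ln (k + 1) - 2 * \<tau> / (k + 1) - 2 * \<tau> * (2 * a * \<tau>)"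
    by (simp add: f_def e2 power2_eq_square)
  also have "ln (k + k\<^sup>2) = ln (k + 1) + \<tau>"
    using k ln_mult_pos[of k "k + 1"] by (simp add: \<tau>_def power2_eq_square algebra_simps)
  also have "ln (k + 1) + \<tau> - ln (k + 1) - 2 * \<tau> / (k + 1) - 2 * \<tau> * (2 * a * \<tau>) = 0"
    unfolding \<tau>a using k by (simp add: divide_simps) algebra
  finally have f2: "f (2 * \<tau>) = 0" .
  have cvx: "convex_on {..\<tau>} g"
  proof (rule f''_ge0_imp_convex[OF _ dg dh])
    fix x assume "x \<in> {..\<tau>}"
    then have "exp x \<le> k" using \<tau>(2) by (metis atMost_iff exp_le_cancel_iff)
    then show "0 \<le> h' x" using k pos[of x] by (auto simp: h'_def intro!: divide_nonneg_nonneg)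
  qed simp
  have ccv: "convex_on {\<tau>..} (\<lambda>x. - g x)"
  proof (rule f''_ge0_imp_convex[where f' = "\<lambda>x. - h x" and f'' = "\<lambda>x. - h' x"])
    fix x assume "x \<in> {\<tau>..}"
    then have "k \<le> exp x" using \<tau>(2) by (metis atLeast_iff exp_le_cancel_iff)
    then show "0 \<le> - h' x" using k pos[of x]
      by (auto simp: h'_def intro!: divide_nonpos_nonneg mult_nonneg_nonpos)
  qed (auto intro!: derivative_eq_intros dg dh)
  have s1: "g x \<le> 0" if "0 \<le> x" "x \<le> \<tau>" for x
    using convex_onD_Icc''[of 0 \<tau> g x] convex_on_subset[OF cvx, of "{0..\<tau>}"] that g0 g1 by auto
  have s2: "g x \<ge> 0" if "\<tau> \<le> x" "x \<le> 2 * \<tau>" for x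
    using convex_onD_Icc''[of \<tau> "2*\<tau>" "\<lambda>x. - g x" x] convex_on_subset[OF ccv, of "{\<tau>..2*\<tau>}"] that g1 g2 by auto
  have s3: "g x \<le> 0" if "2 * \<tau> \<le> x" for x
  proof -
    \<comment> \<open>The concave function \<open>g\<close> lies above its chord from
      \<open>\<tau>\<close> to \<open>x\<close>; since \<open>g\<close> vanishes at
      \<open>\<tau>\<close> and at the intermediate point \<open>2 * \<tau>\<close>, the chord
      cannot end above zero.\<close>
    have "- g (2 * \<tau>) \<le> (- g x - - g \<tau>) / (x - \<tau>) * (2 * \<tau> - \<tau>) + - g \<tau>"
      using convex_onD_Icc'[of \<tau> x "\<lambda>x. - g x" "2 * \<tau>"] convex_on_subset[OF ccv, of "{\<tau>..x}"] that \<tau>(1) by auto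
    then have "g x / (x - \<tau>) * \<tau> \<le> 0" using g1 g2 by simp
    then show ?thesis using that \<tau>(1) by (simp add: mult_le_0_iff divide_le_0_iff)
  qed
  \<comment> \<open>By the signs of \<open>g\<close>, \<open>f\<close> falls from \<open>0\<close>,
    climbs back to \<open>0\<close> at \<open>2 * \<tau>\<close>, and falls from there on.\<close>
  have "f t \<le> 0"
  proof -
    consider "t \<le> \<tau>" | "\<tau> \<le> t" "t \<le> 2 * \<tau>" | "2 * \<tau> \<le> t" by linarith
    then show ?thesis
    proof cases
      case 1
      have "f t \<le> f 0"
        by (rule DERIV_nonpos_imp_nonincreasing) (use 1 t s1 df in \<open>auto intro!: exI\<close>)
      then show ?thesis using f0 by simp
    next
      case 2
      have "f t \<le> f (2 * \<tau>)"
        by (rule DERIV_nonneg_imp_nondecreasing) (use 2 s2 df in \<open>auto intro!: exI\<close>)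
      then show ?thesis using f2 by simp
    next
      case 3
      have "f t \<le> f (2 * \<tau>)"
        by (rule DERIV_nonpos_imp_nonincreasing) (use 3 s3 df in \<open>auto intro!: exI\<close>)
      then show ?thesis using f2 by simp
    qed
  qed
  then show ?thesis by (simp add: f_def a_def)
qed

section \<open>Sub-Gaussian bound for a centred uniform basis vector\<close>

lemma sum_exp_centered_le:
  fixes z :: "'a \<Rightarrow> real"
  assumes I: "finite I" "card I = L" and L: "2 \<le> L" and z0: "(\<Sum>a\<in>I. z a) = 0"
  shows "(\<Sum>a\<in>I. exp (z a)) \<le> L * exp ((\<Sum>a\<in>I. (z a)\<^sup>2) / (2 * real L * (toh_threshold L)\<^sup>2))"
proof -
  define S where "S = (\<Sum>a\<in>I. (z a)\<^sup>2)"
  text \<open>The extremal configuration has one coordinate \<open>d - d / L\<close> and all others \<open>- d / L\<close>.  The quadratic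
    that touches \<open>exp\<close> at \<open>- d / L\<close> and meets it again at \<open>d - d / L\<close> dominates it at every \<open>z a\<close>.\<close>
  define d where "d = sqrt (S * L / (L - 1))"
  define C where "C = (exp d - 1 - d) / d\<^sup>2"
  have L1: "real L - 1 > 0" using L by simp
  have S0: "S \<ge> 0" by (simp add: S_def sum_nonneg)
  have d0: "d \<ge> 0" using S0 L1 by (simp add: d_def)
  \<comment> \<open>Equivalently \<open>S = d\<^sup>2 * (L - 1) / L\<close>: the extremal
    configuration has the same sum of squares as \<open>z\<close>.\<close>
  have d2: "d\<^sup>2 = S * L / (real L - 1)" using S0 L1 by (simp add: d_def)
  have card_diff: "card (I - {a}) = L - 1" if "a \<in> I" for a using I that by simp
  \<comment> \<open>The quadratic dominates \<open>exp\<close> only up to its second contact point.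
    Cauchy-Schwarz on the other coordinates, which sum to \<open>- z a\<close>, shows that no
    coordinate exceeds the extremal one.\<close>
  have zle: "z a + d / L \<le> d" if a: "a \<in> I" for a
  proof -
    have "z a = - (\<Sum>b\<in>I-{a}. z b)" using z0 a I(1) by (simp add: sum.remove[of I a])
    then have "(z a)\<^sup>2 = (\<Sum>b\<in>I-{a}. 1 * z b)\<^sup>2" by simp
    also have "\<dots> \<le> (\<Sum>b\<in>I-{a}. 1\<^sup>2) * (\<Sum>b\<in>I-{a}. (z b)\<^sup>2)" by (rule Cauchy_Schwarz_ineq_sum)
    also have "\<dots> = (real L - 1) * (S - (z a)\<^sup>2)"
      using a I L by (simp add: S_def card_diff sum.remove[of I a] of_nat_diff)
    finally have "real L * (z a)\<^sup>2 \<le> (real L - 1) * S" by (simp add: algebra_simps)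
    then have "(z a)\<^sup>2 \<le> (real L - 1) * S / L" using L by (simp add: field_simps)
    also have "\<dots> = (d * (real L - 1) / L)\<^sup>2"
      using L L1 by (simp add: d2 power_mult_distrib power_divide) (simp add: field_simps power2_eq_square)
    finally have "z a \<le> d * (real L - 1) / L"
      by (rule power2_le_imp_le) (use d0 L1 in auto)
    then show ?thesis using L by (simp add: field_simps)
  qed
  \<comment> \<open>This is the bound at the extremal configuration. Inserting \<open>d2\<close>
    into \<open>kearns_saul\<close> with \<open>k = L - 1\<close> produces exactly the formula of
    \<open>toh_threshold\<close>.\<close>
  have ks: "ln (real L - 1 + exp d) \<le> ln L + d / L + S / (2 * real L * (toh_threshold L)\<^sup>2)"
  proof (cases "L = 2")
    case True
    then show ?thesis using hoeffding_bernoulli_half[OF d0] d2 by (simp add: toh_threshold_def)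
  next
    case False
    with L have L2: "real L - 2 > 0" and k: "1 < real L - 1" by auto
    have lnp: "ln (real L - 1) > 0" using k by simp
    have th: "(toh_threshold L)\<^sup>2 = 2 * (real L - 1) * ln (real L - 1) / (real L * (real L - 2))"
      using False L2 lnp by (simp add: toh_threshold_def)
    have "S / (2 * real L * (toh_threshold L)\<^sup>2) = (real L - 1 - 1) / (4 * L * ln (real L - 1)) * d\<^sup>2"
      using L L1 L2 lnp unfolding th d2 by (simp add: field_simps)
    then show ?thesis using kearns_saul[OF k d0] by simp
  qed
  show ?thesis
  proof (cases "d = 0")
    case True
    then have "S = 0" using d2 L L1 by simp
    then have "z a = 0" if "a \<in> I" for a using that I(1) by (simp add: S_def sum_nonneg_eq_0_iff)
    then show ?thesis using I by simp
  next
    case False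
    with d0 have d: "0 < d" by simp
    have "(\<Sum>a\<in>I. exp (z a)) = exp (- d / L) * (\<Sum>a\<in>I. exp (z a + d / L))"
      by (simp add: sum_distrib_left mult_exp_exp)
    also have "(\<Sum>a\<in>I. exp (z a + d / L)) \<le> (\<Sum>a\<in>I. 1 + (z a + d / L) + C * (z a + d / L)\<^sup>2)"
      unfolding C_def by (rule sum_mono) (rule exp_le_quadratic[OF d zle])
    \<comment> \<open>After summation the quadratic sees \<open>z\<close> only through its sum and
      \<open>S\<close>, so the total is the one for the extremal configuration, where quadratic and
      \<open>exp\<close> agree.\<close>
    also have "\<dots> = L + d + C * (\<Sum>a\<in>I. (z a + d / L)\<^sup>2)"
      using I L z0 by (simp add: sum.distrib sum_distrib_left)
    also have "(\<Sum>a\<in>I. (z a + d / L)\<^sup>2) = S + 2 * d / L * (\<Sum>a\<in>I. z a) + d\<^sup>2 / L"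
      using I L by (simp add: S_def power2_sum sum.distrib sum_distrib_left sum_divide_distrib power_divide)
        (simp add: power2_eq_square ac_simps)
    also have "\<dots> = d\<^sup>2" using z0 L L1 by (simp add: d2 field_simps)
    also have "L + d + C * d\<^sup>2 = real L - 1 + exp d" using d by (simp add: C_def)
    also have "real L - 1 + exp d = exp (ln (real L - 1 + exp d))" using L1 by (simp add: add_pos_pos)
    also have "\<dots> \<le> exp (ln L + d / L + S / (2 * real L * (toh_threshold L)\<^sup>2))" using ks by simp
    also have "exp (- d / L) * \<dots> = L * exp (S / (2 * real L * (toh_threshold L)\<^sup>2))"
      using L by (simp add: exp_add exp_minus)
    finally show ?thesis by (simp add: S_def)
  qed
qed

section \<open>Gaussian linearisation of squared label counts\<close>

abbreviation std_normal :: "real measure" where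
  "std_normal \<equiv> density lborel std_normal_density"

lemma nn_integral_normal_density:
  assumes "0 < \<sigma>"
  shows "(\<integral>\<^sup>+x. normal_density \<mu> \<sigma> x \<partial>lborel) = 1"
  using assms by (subst nn_integral_eq_integral) auto

text \<open>Completing the square leaves a constant times the normal density with mean
  \<open>t\<close>. Read from right to left, it replaces the exponential of a square by an average
  of exponentials of linear forms.\<close>

lemma std_normal_mgf: "(\<integral>\<^sup>+x. exp (t * x) \<partial>std_normal) = exp (t\<^sup>2 / 2)"
proof -
  have "(\<integral>\<^sup>+x. exp (t * x) \<partial>std_normal) = (\<integral>\<^sup>+x. ennreal (exp (t\<^sup>2 / 2)) * normal_density t 1 x \<partial>lborel)"
    by (subst nn_integral_density)
       (auto simp: ennreal_mult' [symmetric] normal_density_def mult_exp_exp power2_eq_square field_simps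
         intro!: nn_integral_cong)
  also have "\<dots> = exp (t\<^sup>2 / 2)"
    by (subst nn_integral_cmult) (auto simp: nn_integral_normal_density)
  finally show ?thesis .
qed

text \<open>The integrand is a multiple of the normal density with variance
  \<open>1 / (1 - b)\<close>. In the application \<open>b < 1\<close> expresses that the signal is
  below the threshold.\<close>

lemma std_normal_square_mgf:
  assumes "b < 1"
  shows "(\<integral>\<^sup>+x. exp (b * x\<^sup>2 / 2) \<partial>std_normal) = 1 / sqrt (1 - b)"
proof -
  let ?\<sigma> = "1 / sqrt (1 - b)"
  have *: "std_normal_density x * exp (b * x\<^sup>2 / 2) = ?\<sigma> * normal_density 0 ?\<sigma> x" for x
  proof -
    have "std_normal_density x * exp (b * x\<^sup>2 / 2) = 1 / sqrt (2 * pi) * exp (- ((1 - b) * x\<^sup>2 / 2))"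
      by (simp add: std_normal_density_def mult_exp_exp field_simps)
    moreover have "?\<sigma> * normal_density 0 ?\<sigma> x = 1 / sqrt (2 * pi) * exp (- ((1 - b) * x\<^sup>2 / 2))"
      using assms by (simp add: normal_density_def power_divide real_sqrt_divide mult.commute)
    ultimately show ?thesis by simp
  qed
  have "(\<integral>\<^sup>+x. exp (b * x\<^sup>2 / 2) \<partial>std_normal)
      = (\<integral>\<^sup>+x. ennreal (std_normal_density x) * ennreal (exp (b * x\<^sup>2 / 2)) \<partial>lborel)"
    by (subst nn_integral_density) auto
  also have "\<dots> = (\<integral>\<^sup>+x. ennreal ?\<sigma> * normal_density 0 ?\<sigma> x \<partial>lborel)"
    using assms by (intro nn_integral_cong) (simp add: ennreal_mult'[symmetric] * del: times_divide_eq_left)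
  also have "\<dots> = 1 / sqrt (1 - b)"
    using assms by (subst nn_integral_cmult) (auto simp: nn_integral_normal_density)
  finally show ?thesis .
qed

text \<open>After division by \<open>L ^ n\<close> this bounds an exponential moment of a uniform
  labelling by a constant free of \<open>n\<close>.\<close>

lemma sum_exp_square_counts_le:
  assumes I: "finite I" "card I = L" and L: "2 \<le> L" and n: "0 < n"
    and lam: "0 \<le> lam" "lam < (toh_threshold L)\<^sup>2"
  shows "(\<Sum>k\<in>{..<n} \<rightarrow>\<^sub>E I. exp (lam * L / (2 * real n) * (\<Sum>a\<in>I. (real (card {u\<in>{..<n}. k u = a}) - n / L)\<^sup>2)))
     \<le> real L ^ n * (1 / sqrt (1 - lam / (toh_threshold L)\<^sup>2)) ^ L"
proof -
  define x where "x k a = real (card {u\<in>{..<n}. k u = a}) - n / L" for k :: "nat \<Rightarrow> 'a" and a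
  define s where "s = sqrt (lam * L / n)"
  define b where "b = lam / (toh_threshold L)\<^sup>2"
  define zb where "zb z = (\<Sum>a\<in>I. z a) / L" for z :: "'a \<Rightarrow> real"
  let ?K = "{..<n} \<rightarrow>\<^sub>E I"
  let ?P = "Pi\<^sub>M I (\<lambda>_. std_normal)"
  interpret N: prob_space std_normal by (rule prob_space_normal_density) simp
  interpret P: product_prob_space "\<lambda>_. std_normal" I ..
  have th: "0 < (toh_threshold L)\<^sup>2" using lam by linarith
  have b: "0 \<le> b" "b < 1" using lam th by (auto simp: b_def)
  have s2: "s\<^sup>2 = lam * L / n" using lam by (simp add: s_def)
  have finK: "finite ?K" using I by (simp add: finite_PiE)
  \<comment> \<open>Regrouping the vertices by label turns the centring \<open>n / L\<close> of the
    counts into a centring of \<open>z\<close>, as \<open>sum_exp_centered_le\<close>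
    requires.\<close>
  have lin: "(\<Sum>a\<in>I. x k a * z a) = (\<Sum>u<n. z (k u) - zb z)" if k: "k \<in> ?K" for k z
  proof -
    have "(\<Sum>u<n. z (k u)) = (\<Sum>u<n. \<Sum>a\<in>I. if k u = a then z a else 0)"
      using k I by (intro sum.cong) (auto simp: PiE_mem)
    also have "\<dots> = (\<Sum>a\<in>I. \<Sum>u<n. if k u = a then z a else 0)" by (rule sum.swap)
    also have "\<dots> = (\<Sum>a\<in>I. real (card {u\<in>{..<n}. k u = a}) * z a)"
      by (simp add: sum.If_cases Int_def)
    finally show ?thesis
      by (simp add: x_def sum_subtractf left_diff_distrib zb_def sum_distrib_left sum_divide_distrib)
  qed
  have meas: "(\<lambda>z. ennreal (exp (s * (\<Sum>a\<in>I. x k a * z a)))) \<in> borel_measurable ?P" for k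
    by measurable
  have meas2: "(\<lambda>z. ennreal (exp (b * (\<Sum>a\<in>I. (z a)\<^sup>2) / 2))) \<in> borel_measurable ?P"
    by measurable
  \<comment> \<open>Each label \<open>a\<close> gets its own independent standard normal variable,
    since the exponent is a sum of squares over the labels.\<close>
  have "(\<Sum>k\<in>?K. ennreal (exp (s\<^sup>2 / 2 * (\<Sum>a\<in>I. (x k a)\<^sup>2)))) =
      (\<Sum>k\<in>?K. \<Prod>a\<in>I. \<integral>\<^sup>+z. exp (s * x k a * z) \<partial>std_normal)"
  proof (rule sum.cong[OF refl])
    fix k
    have "exp (s\<^sup>2 / 2 * (\<Sum>a\<in>I. (x k a)\<^sup>2)) = (\<Prod>a\<in>I. exp ((s * x k a)\<^sup>2 / 2))"
      by (simp add: exp_sum[OF I(1), symmetric] sum_distrib_left power_mult_distrib)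
    then show "ennreal (exp (s\<^sup>2 / 2 * (\<Sum>a\<in>I. (x k a)\<^sup>2))) =
        (\<Prod>a\<in>I. \<integral>\<^sup>+z. exp (s * x k a * z) \<partial>std_normal)"
      by (simp add: std_normal_mgf prod_ennreal)
  qed
  also have "\<dots> = (\<Sum>k\<in>?K. \<integral>\<^sup>+z. (\<Prod>a\<in>I. ennreal (exp (s * x k a * z a))) \<partial>?P)"
    by (intro sum.cong refl P.product_nn_integral_prod[symmetric] I(1)) measurable
  also have "\<dots> = (\<Sum>k\<in>?K. \<integral>\<^sup>+z. exp (s * (\<Sum>a\<in>I. x k a * z a)) \<partial>?P)"
    by (simp add: prod_ennreal exp_sum[OF I(1), symmetric] sum_distrib_left mult.assoc)
  also have "\<dots> = (\<integral>\<^sup>+z. (\<Sum>k\<in>?K. ennreal (exp (s * (\<Sum>a\<in>I. x k a * z a)))) \<partial>?P)"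
    by (rule nn_integral_sum[symmetric]) (rule meas)
  also have "\<dots> \<le> (\<integral>\<^sup>+z. ennreal (L ^ n) * exp (b * (\<Sum>a\<in>I. (z a)\<^sup>2) / 2) \<partial>?P)"
  proof (rule nn_integral_mono)
    fix z :: "'a \<Rightarrow> real"
    let ?y = "\<lambda>a. s * (z a - zb z)"
    have "(\<Sum>k\<in>?K. exp (s * (\<Sum>a\<in>I. x k a * z a))) = (\<Sum>k\<in>?K. \<Prod>u<n. exp (?y (k u)))"
      by (intro sum.cong refl) (simp add: lin exp_sum[symmetric] sum_distrib_left)
    \<comment> \<open>For fixed \<open>z\<close> the vertices are decoupled, so the sum over all
      labellings is an \<open>n\<close>-th power.\<close>
    also have "\<dots> = (\<Sum>a\<in>I. exp (?y a)) ^ n"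
      using I by (subst prod_sum_PiE[symmetric]) auto
    also have "\<dots> \<le> (L * exp ((\<Sum>a\<in>I. (?y a)\<^sup>2) / (2 * real L * (toh_threshold L)\<^sup>2))) ^ n"
    proof (rule power_mono)
      have "(\<Sum>a\<in>I. ?y a) = 0"
        using I L by (simp add: sum_distrib_left[symmetric] sum_subtractf zb_def)
      then show "(\<Sum>a\<in>I. exp (?y a)) \<le> L * exp ((\<Sum>a\<in>I. (?y a)\<^sup>2) / (2 * real L * (toh_threshold L)\<^sup>2))"
        by (rule sum_exp_centered_le[OF I L])
    qed (simp add: sum_nonneg)
    also have "\<dots> = L ^ n * exp (n * ((\<Sum>a\<in>I. (?y a)\<^sup>2) / (2 * real L * (toh_threshold L)\<^sup>2)))"
      by (simp only: power_mult_distrib exp_of_nat_mult of_nat_power)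
    \<comment> \<open>The factor \<open>n\<close> from the power cancels the \<open>1 / n\<close> in
      \<open>s\<^sup>2\<close>; this makes the final bound uniform in \<open>n\<close>.\<close>
    also have "n * ((\<Sum>a\<in>I. (?y a)\<^sup>2) / (2 * real L * (toh_threshold L)\<^sup>2)) = b * (\<Sum>a\<in>I. (z a - zb z)\<^sup>2) / 2"
    proof -
      have "(\<Sum>a\<in>I. (?y a)\<^sup>2) = lam * L / n * (\<Sum>a\<in>I. (z a - zb z)\<^sup>2)"
        by (simp only: power_mult_distrib sum_distrib_left s2)
      then show ?thesis using n L th by (simp add: b_def)
    qed
    \<comment> \<open>Dropping the mean lets the remaining Gaussian integral factor over the
      labels.\<close>
    also have "(\<Sum>a\<in>I. (z a - zb z)\<^sup>2) \<le> (\<Sum>a\<in>I. (z a)\<^sup>2)"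
    proof -
      have "(\<Sum>a\<in>I. (z a - zb z)\<^sup>2) = (\<Sum>a\<in>I. (z a)\<^sup>2) - 2 * zb z * (\<Sum>a\<in>I. z a) + L * (zb z)\<^sup>2"
        using I by (simp add: power2_diff sum.distrib sum_subtractf sum_distrib_left sum_distrib_right ac_simps)
      also have "(\<Sum>a\<in>I. z a) = L * zb z" using L by (simp add: zb_def)
      finally show ?thesis by (simp add: power2_eq_square)
    qed
    finally have "(\<Sum>k\<in>?K. exp (s * (\<Sum>a\<in>I. x k a * z a))) \<le> L ^ n * exp (b * (\<Sum>a\<in>I. (z a)\<^sup>2) / 2)"
      using b(1) by (simp add: mult_left_mono divide_right_mono)
    then show "(\<Sum>k\<in>?K. ennreal (exp (s * (\<Sum>a\<in>I. x k a * z a))))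
        \<le> ennreal (L ^ n) * exp (b * (\<Sum>a\<in>I. (z a)\<^sup>2) / 2)"
      by (simp add: sum_ennreal ennreal_mult'[symmetric] ennreal_leI del: ennreal_power)
  qed
  also have "\<dots> = ennreal (L ^ n) * (\<integral>\<^sup>+z. exp (b * (\<Sum>a\<in>I. (z a)\<^sup>2) / 2) \<partial>?P)"
    by (rule nn_integral_cmult) (rule meas2)
  also have "(\<integral>\<^sup>+z. exp (b * (\<Sum>a\<in>I. (z a)\<^sup>2) / 2) \<partial>?P) = (\<integral>\<^sup>+z. (\<Prod>a\<in>I. ennreal (exp (b * (z a)\<^sup>2 / 2))) \<partial>?P)"
    by (simp add: prod_ennreal exp_sum[OF I(1), symmetric] sum_distrib_left sum_divide_distrib)
  also have "\<dots> = (\<Prod>a\<in>I. \<integral>\<^sup>+z. exp (b * z\<^sup>2 / 2) \<partial>std_normal)"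
    by (rule P.product_nn_integral_prod[OF I(1)]) measurable
  also have "\<dots> = ennreal ((1 / sqrt (1 - b)) ^ L)"
    using b I by (simp add: std_normal_square_mgf ennreal_power)
  also have "ennreal (real (L ^ n)) * \<dots> = ennreal (L ^ n * (1 / sqrt (1 - b)) ^ L)"
    by (rule ennreal_mult'[symmetric]) simp
  finally have "ennreal (\<Sum>k\<in>?K. exp (s\<^sup>2 / 2 * (\<Sum>a\<in>I. (x k a)\<^sup>2))) \<le> ennreal (L ^ n * (1 / sqrt (1 - b)) ^ L)"
    by (simp add: sum_ennreal)
  then have "(\<Sum>k\<in>?K. exp (s\<^sup>2 / 2 * (\<Sum>a\<in>I. (x k a)\<^sup>2))) \<le> L ^ n * (1 / sqrt (1 - b)) ^ L"
    using b by (subst (asm) ennreal_le_iff) auto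
  moreover have "s\<^sup>2 / 2 = lam * L / (2 * real n)" by (simp add: s2)
  ultimately show ?thesis by (simp only: x_def b_def of_nat_power)
qed

section \<open>Edge sums in terms of label counts\<close>

lemma sum_of_bool_mult_of_bool:
  assumes "finite I" "x \<in> I"
  shows "(\<Sum>a\<in>I. of_bool (x = a) * of_bool (y = a)) = (of_bool (x = y) :: real)"
proof (cases "x = y")
  case True
  then have "(\<Sum>a\<in>I. of_bool (x = a) * of_bool (y = a)) = (\<Sum>a\<in>I. if x = a then 1 else 0 :: real)"
    by (intro sum.cong) auto
  then show ?thesis using True assms by simp
next
  case False
  then show ?thesis by (auto intro: sum.neutral)
qed

abbreviation toh_edges :: "nat \<Rightarrow> (nat \<times> nat) set" where
  "toh_edges n \<equiv> {(u, v). u < v \<and> v < n}"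

lemma finite_toh_edges: "finite (toh_edges n)"
  by (rule finite_subset[of _ "{..<n} \<times> {..<n}"]) auto

lemma sum_symmetric_eq_edges:
  fixes f :: "nat \<Rightarrow> nat \<Rightarrow> real"
  assumes "\<And>u v. f u v = f v u"
  shows "(\<Sum>u<n. \<Sum>v<n. f u v) = 2 * (\<Sum>(u, v)\<in>toh_edges n. f u v) + (\<Sum>u<n. f u u)"
proof -
  let ?E = "toh_edges n"
  have "{..<n} \<times> {..<n} = ?E \<union> (prod.swap ` ?E \<union> (\<lambda>u. (u, u)) ` {..<n})"
    by (auto simp: image_iff)
  then have "(\<Sum>(u, v)\<in>{..<n} \<times> {..<n}. f u v) =
      (\<Sum>(u, v)\<in>?E \<union> (prod.swap ` ?E \<union> (\<lambda>u. (u, u)) ` {..<n}). f u v)" by simp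
  also have "\<dots> = (\<Sum>(u, v)\<in>?E. f u v) + (\<Sum>(u, v)\<in>prod.swap ` ?E \<union> (\<lambda>u. (u, u)) ` {..<n}. f u v)"
    by (rule sum.union_disjoint) (auto simp: finite_toh_edges)
  also have "(\<Sum>(u, v)\<in>prod.swap ` ?E \<union> (\<lambda>u. (u, u)) ` {..<n}. f u v) =
      (\<Sum>(u, v)\<in>prod.swap ` ?E. f u v) + (\<Sum>(u, v)\<in>(\<lambda>u. (u, u)) ` {..<n}. f u v)"
    by (rule sum.union_disjoint) (auto simp: finite_toh_edges)
  also have "(\<Sum>(u, v)\<in>prod.swap ` ?E. f u v) = (\<Sum>(u, v)\<in>?E. f u v)"
    by (subst sum.reindex) (auto intro!: sum.cong inj_onI simp: assms)
  also have "(\<Sum>(u, v)\<in>(\<lambda>u. (u, u)) ` {..<n}. f u v) = (\<Sum>u<n. f u u)"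
    by (subst sum.reindex) (auto intro!: inj_onI)
  finally show ?thesis by (simp add: sum.cartesian_product)
qed

text \<open>Over all ordered pairs the sum equals \<open>L\<close> times the sum of the squared
  centred counts. Passing to edges halves it after discarding the diagonal
  \<open>n * (L - 1)\<close>, whose sign gives the inequality.\<close>

lemma sum_edges_le_square_counts:
  assumes I: "finite I" "card I = L" and L: "1 \<le> L" and k: "k \<in> {..<n} \<rightarrow>\<^sub>E I"
  shows "(\<Sum>(u, v)\<in>toh_edges n. real L * of_bool (k u = k v) - 1)
    \<le> L / 2 * (\<Sum>a\<in>I. (real (card {u\<in>{..<n}. k u = a}) - n / L)\<^sup>2)"
proof -
  define N where "N a = real (card {u\<in>{..<n}. k u = a})" for a
  have kI: "k u \<in> I" if "u < n" for u using k that by auto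
  have N: "N a = (\<Sum>u<n. of_bool (k u = a))" for a
    by (simp add: N_def of_bool_def sum.If_cases Int_def)
  have sN: "(\<Sum>a\<in>I. N a) = n"
    unfolding N by (subst sum.swap) (simp add: of_bool_def kI I)
  have "(\<Sum>u<n. \<Sum>v<n. of_bool (k u = k v)) = (\<Sum>u<n. \<Sum>v<n. \<Sum>a\<in>I. of_bool (k u = a) * of_bool (k v = a) :: real)"
    by (intro sum.cong refl) (simp add: sum_of_bool_mult_of_bool kI I)
  also have "\<dots> = (\<Sum>a\<in>I. \<Sum>u<n. \<Sum>v<n. of_bool (k u = a) * of_bool (k v = a))"
    by (subst sum.swap, subst sum.swap) (simp add: sum.swap[of _ I])
  also have "\<dots> = (\<Sum>a\<in>I. (N a)\<^sup>2)" by (simp only: N power2_eq_square sum_product)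
  finally have N2: "(\<Sum>u<n. \<Sum>v<n. of_bool (k u = k v)) = (\<Sum>a\<in>I. (N a)\<^sup>2)" .
  have "2 * (\<Sum>(u, v)\<in>toh_edges n. real L * of_bool (k u = k v) - 1) + (\<Sum>u<n. real L * of_bool (k u = k u) - 1)
     = (\<Sum>u<n. \<Sum>v<n. real L * of_bool (k u = k v) - 1)"
    by (rule sum_symmetric_eq_edges[symmetric]) (simp add: eq_commute)
  also have "\<dots> = real L * (\<Sum>u<n. \<Sum>v<n. of_bool (k u = k v)) - real n * real n"
    by (simp only: sum_subtractf sum_distrib_left sum_constant card_lessThan mult_1_right)
  finally have 1: "2 * (\<Sum>(u, v)\<in>toh_edges n. real L * of_bool (k u = k v) - 1) + n * (real L - 1)
    = real L * (\<Sum>a\<in>I. (N a)\<^sup>2) - real n * real n"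
    unfolding N2 by simp
  have "(\<Sum>a\<in>I. (N a - n / L)\<^sup>2) = (\<Sum>a\<in>I. (N a)\<^sup>2) - 2 * (n / L) * (\<Sum>a\<in>I. N a) + L * (n / L)\<^sup>2"
    using I by (simp add: power2_diff sum.distrib sum_subtractf sum_distrib_left sum_distrib_right ac_simps sum_divide_distrib)
  then have "real L * (\<Sum>a\<in>I. (N a - n / L)\<^sup>2) = real L * (\<Sum>a\<in>I. (N a)\<^sup>2) - real n * real n"
    using L by (simp add: sN power2_eq_square field_simps)
  moreover have "n * (real L - 1) \<ge> 0" using L by simp
  ultimately show ?thesis using 1 unfolding N_def by linarith
qed

section \<open>The law of the model as an explicit finite sum\<close>

definition toh_weight :: "nat \<Rightarrow> real \<Rightarrow> 'a \<Rightarrow> 'a \<Rightarrow> real" where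
  "toh_weight L p a b = p * of_bool (b = a) + (1 - p) / L"

lemma pmf_toh_entry:
  assumes "finite (carrier G)" "b \<in> carrier G" "0 \<le> p" "p \<le> 1"
  shows "pmf (toh_entry G p a) b = toh_weight (Coset.order G) p a b"
proof -
  have ne: "carrier G \<noteq> {}" using assms by auto
  show ?thesis
    using assms unfolding toh_entry_def toh_weight_def
    by (subst pmf_bind, subst integral_bernoulli_pmf)
       (auto simp: pmf_of_set[OF ne assms(1)] Coset.order_def indicator_def of_bool_def)
qed

text \<open>Each weight is \<open>1 / L\<close> plus \<open>p * (of_bool (b = a) - 1 / L)\<close>.
  The second part sums to zero over \<open>b\<close>, so the cross terms vanish and only a term of
  order \<open>p\<^sup>2\<close> remains.\<close>

lemma sum_toh_weight_mult:
  assumes "finite I" "card I = L" "1 \<le> L" "a \<in> I" "a' \<in> I"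
  shows "(\<Sum>b\<in>I. toh_weight L p a b * toh_weight L p a' b) = (1 + p\<^sup>2 * (real L * of_bool (a = a') - 1)) / L"
proof -
  have 1: "(\<Sum>b\<in>I. of_bool (b = c) :: real) = 1" if "c \<in> I" for c
    using that assms(1) by (simp add: of_bool_def)
  have 2: "(\<Sum>b\<in>I. of_bool (b = a) * of_bool (b = a') :: real) = of_bool (a = a')"
    using sum_of_bool_mult_of_bool[of I a a'] assms by (simp add: eq_commute)
  have "(\<Sum>b\<in>I. toh_weight L p a b * toh_weight L p a' b) =
    (\<Sum>b\<in>I. p\<^sup>2 * (of_bool (b = a) * of_bool (b = a')) + p * (1 - p) / L * of_bool (b = a)
       + p * (1 - p) / L * of_bool (b = a') + ((1 - p) / L)\<^sup>2)"
    by (intro sum.cong refl) (simp add: toh_weight_def power2_eq_square algebra_simps)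
  also have "\<dots> = p\<^sup>2 * of_bool (a = a') + p * (1 - p) / L + p * (1 - p) / L + L * ((1 - p) / L)\<^sup>2"
    using assms by (simp only: sum.distrib sum_distrib_left[symmetric] 1 2) simp
  also have "\<dots> = (1 + p\<^sup>2 * (real L * of_bool (a = a') - 1)) / L"
    using assms by (simp add: field_simps power2_eq_square)
  finally show ?thesis .
qed

text \<open>The deterministic map \<open>toh_matrix\<close> is the same for every \<open>pt\<close>,
  so an event can be pulled back to the entries above the diagonal, which are independent given
  \<open>g\<close>.\<close>

lemma measure_ToH:
  fixes G :: "('a, 'b) monoid_scheme" (structure) and pt :: real
  assumes G: "group G" "finite (carrier G)" "Coset.order G = L"
    and p: "0 \<le> p" "p \<le> 1" "p = pt / sqrt n"
  shows "measure (measure_pmf (ToH n pt G)) B =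
    (\<Sum>y | y \<in> toh_edges n \<rightarrow>\<^sub>E carrier G \<and> toh_matrix G n y \<in> B. \<Sum>g\<in>{..<n} \<rightarrow>\<^sub>E carrier G.
       \<Prod>(u, v)\<in>toh_edges n. toh_weight L p (g u \<otimes>\<^bsub>G\<^esub> inv\<^bsub>G\<^esub> (g v)) (y (u, v))) / real L ^ n"
proof -
  interpret group G by fact
  let ?E = "toh_edges n" and ?\<Gamma> = "{..<n} \<rightarrow>\<^sub>E carrier G" and ?\<Omega> = "toh_edges n \<rightarrow>\<^sub>E carrier G"
  let ?q = "\<lambda>g (u, v). toh_entry G p (g u \<otimes>\<^bsub>G\<^esub> inv\<^bsub>G\<^esub> (g v))"
  define R where "R g = Pi_pmf ?E undefined (?q g)" for g
  define P where "P = Pi_pmf {..<n} undefined (\<lambda>_. pmf_of_set (carrier G)) \<bind> R"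
  have ne: "carrier G \<noteq> {}" using one_closed by auto
  have fin: "finite ?\<Gamma>" "finite ?\<Omega>" using G by (auto simp: finite_PiE finite_toh_edges)
  have ne\<Gamma>: "?\<Gamma> \<noteq> {}" using ne by (simp add: PiE_eq_empty_iff)
  have PiE_dflt: "PiE_dflt A undefined (\<lambda>_. carrier G) = A \<rightarrow>\<^sub>E carrier G" for A :: "'c set"
    by (auto simp: PiE_dflt_def PiE_def extensional_def Pi_def)
  have ToH: "ToH n pt G = map_pmf (toh_matrix G n) P"
    unfolding ToH_def P_def R_def p(3)[symmetric] by (simp add: map_bind_pmf map_pmf_def bind_assoc_pmf)
  have \<Gamma>: "Pi_pmf {..<n} undefined (\<lambda>_. pmf_of_set (carrier G)) = pmf_of_set ?\<Gamma>"
    using G ne by (subst Pi_pmf_of_set) (auto simp: PiE_dflt)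
  have pmfR: "pmf (R g) y = (\<Prod>(u, v)\<in>?E. toh_weight L p (g u \<otimes>\<^bsub>G\<^esub> inv\<^bsub>G\<^esub> (g v)) (y (u, v)))"
    if y: "y \<in> ?\<Omega>" for g y
  proof -
    have "pmf (R g) y = (\<Prod>e\<in>?E. pmf (?q g e) (y e))"
      unfolding R_def using y by (intro pmf_Pi' finite_toh_edges) (auto simp: PiE_def extensional_def)
    also have "\<dots> = (\<Prod>(u, v)\<in>?E. toh_weight L p (g u \<otimes>\<^bsub>G\<^esub> inv\<^bsub>G\<^esub> (g v)) (y (u, v)))"
    proof (rule prod.cong[OF refl])
      fix e assume "e \<in> ?E"
      then have "y e \<in> carrier G" by (rule PiE_mem[OF y])
      then show "pmf (?q g e) (y e) =
          (case e of (u, v) \<Rightarrow> toh_weight L p (g u \<otimes>\<^bsub>G\<^esub> inv\<^bsub>G\<^esub> (g v)) (y (u, v)))"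
        using p(1,2) by (cases e) (simp add: pmf_toh_entry[OF G(2)] G(3))
    qed
    finally show ?thesis .
  qed
  have pmfP: "pmf P y = (\<Sum>g\<in>?\<Gamma>. pmf (R g) y) / real L ^ n" for y
    unfolding P_def \<Gamma> using fin ne\<Gamma> G(3)
    by (simp add: pmf_bind integral_pmf_of_set card_PiE Coset.order_def)
  have setR: "set_pmf (R g) \<subseteq> ?\<Omega>" if "g \<in> ?\<Gamma>" for g
  proof -
    have entry: "set_pmf (toh_entry G p a) \<subseteq> carrier G" if "a \<in> carrier G" for a
      using that by (auto simp: toh_entry_def set_pmf_of_set[OF ne G(2)] split: if_splits)
    have gu: "g u \<in> carrier G" if "u < n" for u using \<open>g \<in> ?\<Gamma>\<close> that by auto
    have q: "set_pmf (?q g e) \<subseteq> carrier G" if "e \<in> ?E" for e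
    proof -
      obtain u v where e: "e = (u, v)" "u < v" "v < n" using \<open>e \<in> ?E\<close> by auto
      then have "g u \<otimes> inv (g v) \<in> carrier G" using gu by simp
      then show ?thesis unfolding e(1) prod.case by (rule entry)
    qed
    have "set_pmf (R g) \<subseteq> PiE_dflt ?E undefined (\<lambda>_. carrier G)"
      unfolding R_def set_Pi_pmf[OF finite_toh_edges] PiE_dflt_def comp_def
      using q by blast
    then show ?thesis by (simp add: PiE_dflt)
  qed
  have setP: "set_pmf P \<subseteq> ?\<Omega>"
    unfolding P_def \<Gamma> set_bind_pmf set_pmf_of_set[OF ne\<Gamma> fin(1)] using setR by blast
  let ?B = "{y. y \<in> ?\<Omega> \<and> toh_matrix G n y \<in> B}"
  have "measure (measure_pmf (ToH n pt G)) B = measure (measure_pmf P) (toh_matrix G n -` B)"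
    unfolding ToH by simp
  also have "\<dots> = measure (measure_pmf P) ?B"
    by (rule measure_eq_AE) (use setP in \<open>auto simp: AE_measure_pmf_iff\<close>)
  also have "\<dots> = (\<Sum>y\<in>?B. pmf P y)"
    by (rule measure_measure_pmf_finite) (use fin in auto)
  also have "\<dots> = (\<Sum>y\<in>?B. \<Sum>g\<in>?\<Gamma>. pmf (R g) y) / real L ^ n"
    by (simp add: pmfP sum_divide_distrib)
  also have "(\<Sum>y\<in>?B. \<Sum>g\<in>?\<Gamma>. pmf (R g) y) =
    (\<Sum>y\<in>?B. \<Sum>g\<in>?\<Gamma>. \<Prod>(u, v)\<in>?E. toh_weight L p (g u \<otimes>\<^bsub>G\<^esub> inv\<^bsub>G\<^esub> (g v)) (y (u, v)))"
    by (intro sum.cong refl pmfR) auto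
  finally show ?thesis .
qed

section \<open>Second moment of the likelihood ratio\<close>

text \<open>Two labellings predict the same value on an edge exactly when their pointwise quotient
  agrees at its endpoints. This form is valid for nonabelian groups.\<close>

lemma (in group) mult_inv_eq_iff_inv_mult_eq:
  assumes "a \<in> carrier G" "b \<in> carrier G" "c \<in> carrier G" "d \<in> carrier G"
  shows "a \<otimes> inv b = c \<otimes> inv d \<longleftrightarrow> inv c \<otimes> a = inv d \<otimes> b"
proof -
  have "a \<otimes> inv b = c \<otimes> inv d \<longleftrightarrow> a = c \<otimes> inv d \<otimes> b"
    using assms by (metis inv_closed inv_solve_right' m_closed)
  also have "\<dots> \<longleftrightarrow> a = c \<otimes> (inv d \<otimes> b)" using assms by (simp add: m_assoc)
  also have "\<dots> \<longleftrightarrow> inv c \<otimes> a = inv d \<otimes> b"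
    using assms by (metis inv_closed inv_solve_left m_closed)
  finally show ?thesis .
qed

text \<open>Pointwise left translation permutes the labellings; hence the inner sum of the second
  moment does not depend on \<open>h\<close>.\<close>

lemma (in group) sum_translate_PiE:
  fixes F :: "('c \<Rightarrow> 'a) \<Rightarrow> real"
  assumes "h \<in> A \<rightarrow>\<^sub>E carrier G"
  shows "(\<Sum>g\<in>A \<rightarrow>\<^sub>E carrier G. F (\<lambda>u\<in>A. inv (h u) \<otimes> g u)) = (\<Sum>k\<in>A \<rightarrow>\<^sub>E carrier G. F k)"
proof (rule sum.reindex_bij_witness[where i = "\<lambda>k. \<lambda>u\<in>A. h u \<otimes> k u"
      and j = "\<lambda>g. \<lambda>u\<in>A. inv (h u) \<otimes> g u"])
  have h: "h u \<in> carrier G" if "u \<in> A" for u using assms that by auto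
  fix k assume k: "k \<in> A \<rightarrow>\<^sub>E carrier G"
  have ku: "k u \<in> carrier G" if "u \<in> A" for u using k that by auto
  have und: "k u = undefined" if "u \<notin> A" for u using k that by auto
  show "(\<lambda>u\<in>A. h u \<otimes> (\<lambda>u\<in>A. inv (h u) \<otimes> k u) u) = k"
    by (rule ext) (auto simp: h ku und m_assoc[symmetric] restrict_def)
  show "(\<lambda>u\<in>A. inv (h u) \<otimes> (\<lambda>u\<in>A. h u \<otimes> k u) u) = k"
    by (rule ext) (auto simp: h ku und m_assoc[symmetric] restrict_def)
  show "(\<lambda>u\<in>A. inv (h u) \<otimes> k u) \<in> A \<rightarrow>\<^sub>E carrier G" "(\<lambda>u\<in>A. h u \<otimes> k u) \<in> A \<rightarrow>\<^sub>E carrier G"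
    using h ku by auto
qed simp

text \<open>Cauchy-Schwarz under the null law: the squared probability of an event is at most its
  null probability times the second moment of the likelihood ratio.\<close>

lemma measure_ToH_square_le:
  fixes G :: "('a, 'b) monoid_scheme" (structure) and pt :: real
  assumes G: "group G" "finite (carrier G)" "Coset.order G = L" and L: "2 \<le> L" and n: "0 < n"
    and pt: "0 \<le> pt" "pt < toh_threshold L" "pt \<le> sqrt n"
  shows "(measure (measure_pmf (ToH n pt G)) B)\<^sup>2 \<le>
    measure (measure_pmf (ToH n 0 G)) B * (1 / sqrt (1 - pt\<^sup>2 / (toh_threshold L)\<^sup>2)) ^ L"
proof -
  interpret group G by fact
  define E where "E = toh_edges n"
  define \<Gamma> where "\<Gamma> = {..<n} \<rightarrow>\<^sub>E carrier G"
  define \<Omega> where "\<Omega> = E \<rightarrow>\<^sub>E carrier G"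
  define p where "p = pt / sqrt n"
  define W where "W g y = (\<Prod>(u, v)\<in>E. toh_weight L p (g u \<otimes> inv (g v)) (y (u, v)))" for g y
  define B' where "B' = {y. y \<in> \<Omega> \<and> toh_matrix G n y \<in> B}"
  define K where "K = (1 / sqrt (1 - pt\<^sup>2 / (toh_threshold L)\<^sup>2)) ^ L"
  define F where "F k = exp (pt\<^sup>2 * L / (2 * real n) *
      (\<Sum>a\<in>carrier G. (real (card {u\<in>{..<n}. k u = a}) - n / L)\<^sup>2))" for k :: "nat \<Rightarrow> 'a"
  have card: "card (carrier G) = L" using G(3) by (simp add: Coset.order_def)
  have p: "0 \<le> p" "p \<le> 1" using pt n by (auto simp: p_def)
  have p2: "p\<^sup>2 = pt\<^sup>2 / n" by (simp add: p_def power_divide)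
  have finE: "finite E" by (simp add: E_def finite_toh_edges)
  have fin: "finite \<Gamma>" "finite \<Omega>" using G finE by (auto simp: finite_PiE \<Gamma>_def \<Omega>_def)
  have "card \<Gamma> = L ^ n" by (simp add: \<Gamma>_def card_PiE card)
  have B': "B' \<subseteq> \<Omega>" "finite B'" using fin by (auto simp: B'_def)
  have P: "measure (measure_pmf (ToH n pt G)) B = (\<Sum>y\<in>B'. \<Sum>g\<in>\<Gamma>. W g y) / real L ^ n"
    using measure_ToH[OF G p p_def] by (simp add: W_def E_def \<Gamma>_def \<Omega>_def B'_def)
  \<comment> \<open>For \<open>p = 0\<close> every weight is \<open>1 / L\<close>, so the null law
    of the entries is uniform on \<open>\<Omega>\<close>.\<close>
  have "measure (measure_pmf (ToH n 0 G)) B = (\<Sum>y\<in>B'. \<Sum>g\<in>\<Gamma>. 1 / real L ^ card E) / real L ^ n"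
    using measure_ToH[OF G, of 0 0 n B]
    by (simp add: E_def \<Gamma>_def \<Omega>_def B'_def toh_weight_def case_prod_unfold power_one_over)
  also have "\<dots> = card B' / real L ^ card E" using L by (simp add: \<open>card \<Gamma> = L ^ n\<close>)
  finally have Q: "measure (measure_pmf (ToH n 0 G)) B = card B' / real L ^ card E" .
  have corr: "(\<Sum>y\<in>\<Omega>. W g y * W h y) \<le> F (\<lambda>u\<in>{..<n}. inv (h u) \<otimes> g u) / real L ^ card E"
    if g: "g \<in> \<Gamma>" and h: "h \<in> \<Gamma>" for g h
  proof -
    define k where "k = (\<lambda>u\<in>{..<n}. inv (h u) \<otimes> g u)"
    have gh: "g u \<in> carrier G" "h u \<in> carrier G" if "u < n" for u
      using g h that by (auto simp: \<Gamma>_def)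
    have k: "k \<in> \<Gamma>" using gh by (auto simp: k_def \<Gamma>_def)
    have "(\<Sum>y\<in>\<Omega>. W g y * W h y) = (\<Sum>y\<in>\<Omega>. \<Prod>e\<in>E.
        toh_weight L p (g (fst e) \<otimes> inv (g (snd e))) (y e) * toh_weight L p (h (fst e) \<otimes> inv (h (snd e))) (y e))"
      by (simp add: W_def prod.distrib case_prod_unfold)
    also have "\<dots> = (\<Prod>e\<in>E. \<Sum>b\<in>carrier G.
        toh_weight L p (g (fst e) \<otimes> inv (g (snd e))) b * toh_weight L p (h (fst e) \<otimes> inv (h (snd e))) b)"
      unfolding \<Omega>_def by (rule prod_sum_PiE[symmetric]) (use finE G in auto)
    also have "\<dots> = (\<Prod>(u, v)\<in>E. (1 + p\<^sup>2 * (real L * of_bool (k u = k v) - 1)) / L)"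
    proof (rule prod.cong[OF refl], clarify)
      fix u v assume "(u, v) \<in> E"
      then have uv: "u < n" "v < n" by (auto simp: E_def)
      then have "g u \<otimes> inv (g v) = h u \<otimes> inv (h v) \<longleftrightarrow> k u = k v"
        using mult_inv_eq_iff_inv_mult_eq[of "g u" "g v" "h u" "h v"] gh by (simp add: k_def)
      then show "(\<Sum>b\<in>carrier G. toh_weight L p (g (fst (u, v)) \<otimes> inv (g (snd (u, v)))) b
           * toh_weight L p (h (fst (u, v)) \<otimes> inv (h (snd (u, v)))) b) =
         (1 + p\<^sup>2 * (real L * of_bool (k u = k v) - 1)) / L"
        using sum_toh_weight_mult[OF G(2) card, of "g u \<otimes> inv (g v)" "h u \<otimes> inv (h v)" p] L gh uv by simp
    qed
    also have "\<dots> = (\<Prod>(u, v)\<in>E. 1 + p\<^sup>2 * (real L * of_bool (k u = k v) - 1)) / real L ^ card E"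
      by (simp add: case_prod_unfold prod_dividef)
    also have "\<dots> \<le> exp (\<Sum>(u, v)\<in>E. p\<^sup>2 * (real L * of_bool (k u = k v) - 1)) / real L ^ card E"
    proof (rule divide_right_mono)
      \<comment> \<open>The bound \<open>1 + x \<le> exp x\<close> can be multiplied over the edges
        only for nonnegative factors; \<open>p \<le> 1\<close> ensures this.\<close>
      have nonneg: "0 \<le> 1 + p\<^sup>2 * (L * c - 1)" if "0 \<le> c" for c :: real
      proof -
        have "p\<^sup>2 \<le> 1" using p by (simp add: power_le_one)
        moreover have "0 \<le> p\<^sup>2 * (L * c)" using that by simp
        ultimately show ?thesis by (simp add: right_diff_distrib)
      qed
      show "(\<Prod>(u, v)\<in>E. 1 + p\<^sup>2 * (real L * of_bool (k u = k v) - 1))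
          \<le> exp (\<Sum>(u, v)\<in>E. p\<^sup>2 * (real L * of_bool (k u = k v) - 1))"
        unfolding exp_sum[OF finE] case_prod_unfold
        by (intro prod_mono conjI nonneg exp_ge_add_one_self) simp
    qed simp
    also have "(\<Sum>(u, v)\<in>E. p\<^sup>2 * (real L * of_bool (k u = k v) - 1)) = p\<^sup>2 * (\<Sum>(u, v)\<in>E. real L * of_bool (k u = k v) - 1)"
      by (simp add: sum_distrib_left case_prod_unfold)
    also have "exp \<dots> \<le> F k"
    proof -
      have "p\<^sup>2 * (\<Sum>(u, v)\<in>E. real L * of_bool (k u = k v) - 1) \<le>
        p\<^sup>2 * (L / 2 * (\<Sum>a\<in>carrier G. (real (card {u\<in>{..<n}. k u = a}) - n / L)\<^sup>2))"
        unfolding E_def by (intro mult_left_mono sum_edges_le_square_counts[OF G(2) card]) (use L k \<Gamma>_def in auto)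
      then show ?thesis by (simp add: F_def p2)
    qed
    finally show ?thesis by (simp add: k_def divide_right_mono)
  qed
  have "(\<Sum>y\<in>B'. \<Sum>g\<in>\<Gamma>. W g y)\<^sup>2 = (\<Sum>y\<in>B'. 1 * (\<Sum>g\<in>\<Gamma>. W g y))\<^sup>2" by simp
  also have "\<dots> \<le> (\<Sum>y\<in>B'. 1\<^sup>2) * (\<Sum>y\<in>B'. (\<Sum>g\<in>\<Gamma>. W g y)\<^sup>2)" by (rule Cauchy_Schwarz_ineq_sum)
  also have "\<dots> \<le> card B' * (\<Sum>y\<in>\<Omega>. (\<Sum>g\<in>\<Gamma>. W g y)\<^sup>2)"
    using B' fin by (auto intro!: mult_left_mono sum_mono2)
  also have "(\<Sum>y\<in>\<Omega>. (\<Sum>g\<in>\<Gamma>. W g y)\<^sup>2) = (\<Sum>h\<in>\<Gamma>. \<Sum>g\<in>\<Gamma>. \<Sum>y\<in>\<Omega>. W g y * W h y)"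
  proof -
    have "(\<Sum>y\<in>\<Omega>. (\<Sum>g\<in>\<Gamma>. W g y)\<^sup>2) = (\<Sum>y\<in>\<Omega>. \<Sum>h\<in>\<Gamma>. \<Sum>g\<in>\<Gamma>. W g y * W h y)"
      by (simp add: power2_eq_square sum_product mult.commute)
    also have "\<dots> = (\<Sum>h\<in>\<Gamma>. \<Sum>y\<in>\<Omega>. \<Sum>g\<in>\<Gamma>. W g y * W h y)" by (rule sum.swap)
    also have "\<dots> = (\<Sum>h\<in>\<Gamma>. \<Sum>g\<in>\<Gamma>. \<Sum>y\<in>\<Omega>. W g y * W h y)"
      by (intro sum.cong refl) (rule sum.swap)
    finally show ?thesis .
  qed
  also have "\<dots> \<le> (\<Sum>h\<in>\<Gamma>. \<Sum>g\<in>\<Gamma>. F (\<lambda>u\<in>{..<n}. inv (h u) \<otimes> g u) / real L ^ card E)"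
    by (intro sum_mono corr)
  also have "\<dots> = (\<Sum>h\<in>\<Gamma>. (\<Sum>k\<in>\<Gamma>. F k) / real L ^ card E)"
    using sum_translate_PiE[of _ "{..<n}" F]
    by (intro sum.cong refl) (simp add: \<Gamma>_def sum_divide_distrib[symmetric])
  also have "\<dots> = real L ^ n * (\<Sum>k\<in>\<Gamma>. F k) / real L ^ card E" by (simp add: \<open>card \<Gamma> = L ^ n\<close>)
  also have "(\<Sum>k\<in>\<Gamma>. F k) \<le> real L ^ n * K"
    unfolding F_def \<Gamma>_def K_def
    by (rule sum_exp_square_counts_le[OF G(2) card L n]) (use pt in \<open>auto intro: power_strict_mono\<close>)
  finally have "(\<Sum>y\<in>B'. \<Sum>g\<in>\<Gamma>. W g y)\<^sup>2 \<le> card B' * (real L ^ n * (real L ^ n * K) / real L ^ card E)"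
    by (simp add: mult_left_mono divide_right_mono)
  then have "(\<Sum>y\<in>B'. \<Sum>g\<in>\<Gamma>. W g y)\<^sup>2 / (real L ^ n)\<^sup>2 \<le> card B' * (real L ^ n * (real L ^ n * K) / real L ^ card E) / (real L ^ n)\<^sup>2"
    by (rule divide_right_mono) simp
  also have "\<dots> = card B' / real L ^ card E * K" using L by (simp add: power2_eq_square)
  finally show ?thesis by (simp add: P Q power_divide K_def)
qed

section \<open>Contiguity\<close>

theorem theorem6p3:
  fixes G :: "('a, 'b) monoid_scheme" and L :: nat and pt :: real
  assumes "group G"
    and "finite (carrier G)"
    and "Coset.order G = L"
    and "L \<ge> 2"
    and "pt \<ge> 0"
    and "pt < toh_threshold L"
  shows "contiguous (\<lambda>n. measure_pmf (ToH n pt G)) (\<lambda>n. measure_pmf (ToH n 0 G))"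
  unfolding contiguous_def
proof (intro allI impI)
  fix A :: "nat \<Rightarrow> (nat \<times> nat \<Rightarrow> 'a) set"
  assume lim: "(\<lambda>n. measure (measure_pmf (ToH n 0 G)) (A n)) \<longlonglongrightarrow> 0"
  define K where "K = (1 / sqrt (1 - pt\<^sup>2 / (toh_threshold L)\<^sup>2)) ^ L"
  \<comment> \<open>For such \<open>n\<close> one has \<open>0 < n\<close> and
    \<open>pt \<le> sqrt n\<close>, so the Bernoulli parameter is not truncated.\<close>
  have "\<forall>\<^sub>F n in sequentially. pt\<^sup>2 + 1 \<le> real n" by real_asymp
  then have "\<forall>\<^sub>F n in sequentially. (measure (measure_pmf (ToH n pt G)) (A n))\<^sup>2
      \<le> measure (measure_pmf (ToH n 0 G)) (A n) * K"
  proof eventually_elim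
    case (elim n)
    have "0 < real n" using elim zero_le_power2[of pt] by linarith
    then have "0 < n" by simp
    moreover have "pt \<le> sqrt n" using elim by (intro real_le_rsqrt) simp
    ultimately show ?case unfolding K_def using assms by (intro measure_ToH_square_le)
  qed
  moreover have "(\<lambda>n. measure (measure_pmf (ToH n 0 G)) (A n) * K) \<longlonglongrightarrow> 0"
    using tendsto_mult_left_zero[OF lim] .
  ultimately have "(\<lambda>n. (measure (measure_pmf (ToH n pt G)) (A n))\<^sup>2) \<longlonglongrightarrow> 0"
    by (rule tendsto_sandwich[OF always_eventually _ tendsto_const, rotated]) simp
  then show "(\<lambda>n. measure (measure_pmf (ToH n pt G)) (A n)) \<longlonglongrightarrow> 0"
    by simp
qed

end
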